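(* Let $f_{\mathbf w}:\mathbb R^2\to\mathbb R^{d_L}$ be the rational neural network with architecture $\mathbf d=(2,2,\dots,2,d_L)$ with $L$ weight matrices, $\sigma(x)=1/x$, and weights $\mathbf w=(W_1,\dots,W_L)$. Let $P_{12}=\begin{pmatrix}0&1\\1&0\end{pmatrix}$. Define the vectors of linear forms $$p_i(\mathbf x):=(W_iP_{12}W_{i-1}\cdots P_{12}W_1)\mathbf x\qquad(1\le i\le L),$$ with $j$-th entry denoted $p_{j,i}$, and the quadratic forms $$q_{i+1}(\mathbf x):=\tfrac12\,\mathbf x^T(W_iP_{12}W_{i-1}\cdots P_{12}W_1)^TP_{12}(W_iP_{12}W_{i-1}\cdots P_{12}W_1)\mathbf x\qquad(1\le i\le L-1),$$ and set $q_0(\mathbf x)=q_1(\mathbf x)=1$. Then $f_{\mathbf w}$ is the $d_L$-tuple of rational functions $$f_{\mathbf w}(\mathbf x)=\left(\frac{P_{1,\mathbf w}(\mathbf x)}{Q_{\mathbf w}(\mathbf x)},\dots,\frac{P_{d_L,\mathbf w}(\mathbf x)}{Q_{\mathbf w}(\mathbf x)}\right)^\top,$$ where $P_{i,\mathbf w}$ and $Q_{\mathbf w}$ are the homogeneous polynomials $$P_{i,\mathbf w}(\mathbf x)=p_{i,L}(\mathbf x)\,q_{L-1}(\mathbf x)\,q_{L-3}(\mathbf x)\cdots q_{\delta(L+1)}(\mathbf x),\qquad Q_{\mathbf w}(\mathbf x)=q_L(\mathbf x)\,q_{L-2}(\mathbf x)\cdots q_{\delta(L)}(\mathbf x),$$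 with $\delta(n)=0$ if $n$ is even and $\delta(n)=1$ if $n$ is odd.
   Context: The rational neural network is $f_{\mathbf w}=W_L\circ\sigma\circ W_{L-1}\circ\cdots\circ\sigma\circ W_1$, where $W_k$ is $2\times2$ for $k<L$ and $W_L$ is $d_L\times2$, and $\sigma$ acts entrywise as $x\mapsto1/x$. Weights are regarded as variables, so the composition is well defined and the identity is one of rational functions; domain questions are disregarded. *)

theory Defs
  imports
    "HOL-Library.Countable"
    "HOL-Library.Poly_Mapping"
    "HOL-Computational_Algebra.Polynomial_Factorial"
    "Jordan_Normal_Form.Matrix"
begin

text \<open>
  Weights are families \<open>W 1, \<dots>, W L\<close> of matrices over a field; the value \<open>W 0\<close> is never used.
  Layers are counted from 1, as in the mathematics; vector and matrix entries are counted from 0,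
  as in the library.
\<close>

subsection \<open>The network\<close>

text \<open>\<open>layer_out W x k\<close> is the output of the linear map of layer \<open>k\<close>, that is
  \<open>(W k \<circ> \<sigma> \<circ> W (k - 1) \<circ> \<dots> \<circ> \<sigma> \<circ> W 1) x\<close>; index 0 is the input.\<close>

fun layer_out :: "(nat \<Rightarrow> 'a :: field mat) \<Rightarrow> 'a vec \<Rightarrow> nat \<Rightarrow> 'a vec" where
  "layer_out W x 0 = x"
| "layer_out W x (Suc 0) = W 1 *\<^sub>v x"
| "layer_out W x (Suc (Suc k)) = W (Suc (Suc k)) *\<^sub>v map_vec (\<lambda>t. 1 / t) (layer_out W x (Suc k))"

definition network :: "nat \<Rightarrow> (nat \<Rightarrow> 'a :: field mat) \<Rightarrow> 'a vec \<Rightarrow> 'a vec" where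
  "network L W x = layer_out W x L"

text \<open>Division is total in HOL, with \<open>1 / 0 = 0\<close>, so the composition is meaningful only if
  \<open>\<sigma>\<close> is never applied to 0.\<close>

definition network_defined :: "nat \<Rightarrow> (nat \<Rightarrow> 'a :: field mat) \<Rightarrow> 'a vec \<Rightarrow> bool" where
  "network_defined L W x \<longleftrightarrow>
     (\<forall>k\<in>{1..<L}. \<forall>j < dim_vec (layer_out W x k). layer_out W x k $ j \<noteq> 0)"

definition weights_ok :: "nat \<Rightarrow> nat \<Rightarrow> (nat \<Rightarrow> 'a mat) \<Rightarrow> bool" where
  "weights_ok L d W \<longleftrightarrow> (\<forall>k\<in>{1..<L}. W k \<in> carrier_mat 2 2) \<and> W L \<in> carrier_mat d 2"

subsection \<open>The linear forms, the quadratic forms, numerators and denominator\<close>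

definition P12 :: "'a :: field mat" where
  "P12 = mat_of_rows_list 2 [[0, 1], [1, 0]]"

text \<open>\<open>twisted_prod W i = W i * P12 * W (i - 1) * \<dots> * P12 * W 1\<close> for \<open>i \<ge> 1\<close>;
  the value at 0 is never used.\<close>

fun twisted_prod :: "(nat \<Rightarrow> 'a :: field mat) \<Rightarrow> nat \<Rightarrow> 'a mat" where
  "twisted_prod W 0 = 1\<^sub>m 2"
| "twisted_prod W (Suc 0) = W 1"
| "twisted_prod W (Suc (Suc i)) = W (Suc (Suc i)) * P12 * twisted_prod W (Suc i)"

definition p_forms :: "(nat \<Rightarrow> 'a :: field mat) \<Rightarrow> 'a vec \<Rightarrow> nat \<Rightarrow> 'a vec" where
  "p_forms W x i = twisted_prod W i *\<^sub>v x"

fun q_form :: "(nat \<Rightarrow> 'a :: field mat) \<Rightarrow> 'a vec \<Rightarrow> nat \<Rightarrow> 'a" where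
  "q_form W x 0 = 1"
| "q_form W x (Suc 0) = 1"
| "q_form W x (Suc (Suc i)) =
     1 / 2 * (x \<bullet> ((transpose_mat (twisted_prod W (Suc i)) * P12 * twisted_prod W (Suc i)) *\<^sub>v x))"

definition delta :: "nat \<Rightarrow> nat" where
  "delta n = (if even n then 0 else 1)"

text \<open>The products run downwards in steps of two, from \<open>L - 1\<close> to \<open>delta (L + 1)\<close> and from
  \<open>L\<close> to \<open>delta L\<close>.\<close>

definition P_num :: "nat \<Rightarrow> (nat \<Rightarrow> 'a :: field mat) \<Rightarrow> 'a vec \<Rightarrow> nat \<Rightarrow> 'a" where
  "P_num L W x j = p_forms W x L $ j *
     (\<Prod>i | delta (L + 1) \<le> i \<and> i \<le> L - 1 \<and> even (L - 1 - i). q_form W x i)"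

definition Q_den :: "nat \<Rightarrow> (nat \<Rightarrow> 'a :: field mat) \<Rightarrow> 'a vec \<Rightarrow> 'a" where
  "Q_den L W x = (\<Prod>i | delta L \<le> i \<and> i \<le> L \<and> even (L - i). q_form W x i)"

subsection \<open>Weights and inputs as variables\<close>

text \<open>\<open>Wt k i j\<close> is the variable for entry \<open>(i, j)\<close> of the weight matrix of layer \<open>k\<close>, and
  \<open>X j\<close> the variable for input coordinate \<open>j\<close>.\<close>

datatype var = Wt nat nat nat | X nat

text \<open>The order on variables serves only to obtain that the polynomial ring is an integral
  domain, through the type class instances for \<open>poly_mapping\<close>.\<close>

instance var :: countable
  by countable_datatype

instantiation var :: linorder
begin

definition less_eq_var :: "var \<Rightarrow> var \<Rightarrow> bool" where
  "less_eq_var u v \<longleftrightarrow> to_nat u \<le> to_nat v"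

definition less_var :: "var \<Rightarrow> var \<Rightarrow> bool" where
  "less_var u v \<longleftrightarrow> to_nat u < to_nat v"

instance
  by standard (auto simp: less_eq_var_def less_var_def)

end

text \<open>Real polynomials in the weight and input variables, as finitely supported functions from
  monomials (exponent functions) to coefficients, and their field of fractions.\<close>

type_synonym wpoly = "(var \<Rightarrow>\<^sub>0 nat) \<Rightarrow>\<^sub>0 real"
type_synonym wfun = "wpoly fract"

definition var_fun :: "var \<Rightarrow> wfun" where
  "var_fun v = to_fract (Poly_Mapping.single (Poly_Mapping.single v 1) 1)"

definition generic_weights :: "nat \<Rightarrow> nat \<Rightarrow> nat \<Rightarrow> wfun mat" where
  "generic_weights L d k = mat (if k = L then d else 2) 2 (\<lambda>(i, j). var_fun (Wt k i j))"

definition generic_input :: "wfun vec" where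
  "generic_input = vec 2 (\<lambda>j. var_fun (X j))"

text \<open>Homogeneity refers to the input variables; the coefficients are polynomials in the weights.\<close>

definition input_degree :: "(var \<Rightarrow>\<^sub>0 nat) \<Rightarrow> nat" where
  "input_degree m = (\<Sum>j<2. Poly_Mapping.lookup m (X j))"

definition homogeneous_in_input :: "wpoly \<Rightarrow> bool" where
  "homogeneous_in_input f \<longleftrightarrow> (\<exists>n. \<forall>m\<in>Poly_Mapping.keys f. input_degree m = n)"

definition is_homogeneous_poly :: "wfun \<Rightarrow> bool" where
  "is_homogeneous_poly r \<longleftrightarrow> (\<exists>f. homogeneous_in_input f \<and> r = to_fract f)"

end

theory Submission
  imports Defs
begin

text \<open>
  Since \<open>P12\<close> swaps two coordinates, the reciprocal map on vectors without zero entries is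
  \<open>\<sigma>(v) = P12 v / (v\<^sub>0 v\<^sub>1)\<close>, and it inverts scalars: \<open>\<sigma>(c v) = P12 v / (c v\<^sub>0 v\<^sub>1)\<close>.
  The quadratic form \<open>q\<^sub>k\<^sub>+\<^sub>1\<close> is exactly the product of the two entries of \<open>p\<^sub>k\<close>
  (lemma \<open>q_form_eq_entry_product\<close>).  Hence the output of layer \<open>k\<close> is a scalar multiple
  \<open>c\<^sub>k p\<^sub>k\<close> of the vector of linear forms, where \<open>c\<^sub>1 = 1\<close> and
  \<open>c\<^sub>k\<^sub>+\<^sub>1 = 1 / (c\<^sub>k q\<^sub>k\<^sub>+\<^sub>1)\<close>.  Because of the inversion, the factors \<open>q\<close> land alternately
  in the numerator and in the denominator: if \<open>D\<^sub>k\<close> denotes the denominator of the network of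
  depth \<open>k\<close>, then \<open>D\<^sub>k\<^sub>+\<^sub>1 = q\<^sub>k\<^sub>+\<^sub>1 D\<^sub>k\<^sub>-\<^sub>1\<close>, so \<open>c\<^sub>k = D\<^sub>k\<^sub>-\<^sub>1 / D\<^sub>k\<close>
  (lemma \<open>layer_out_eq_smult_p_forms\<close>).  This also shows that the network is defined at a point
  precisely when no entry of \<open>p\<^sub>1, \<dots>, p\<^sub>L\<^sub>-\<^sub>1\<close> vanishes there (lemma \<open>network_defined_iff\<close>).

  The computation is valid over every field in which 2 is invertible, so it covers real weights and
  generic weights alike.  For generic weights it remains to see that no \<open>p\<close> entry is the zero
  polynomial and that everything is homogeneous.  The recursion for \<open>p\<close> uses only sums and products
  of variables, hence never cancels: all polynomials in sight have nonnegative coefficients and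
  are nonzero.  The predicate \<open>positive_form\<close> records this together with the degree in the input.
\<close>

section \<open>The linear and quadratic forms\<close>

lemma mult_mat_vec_entry_2:
  assumes "A \<in> carrier_mat n 2" "v \<in> carrier_vec 2" "j < n"
  shows "(A *\<^sub>v v) $ j = A $$ (j, 0) * v $ 0 + A $$ (j, 1) * v $ 1"
  using assms by (auto simp: scalar_prod_def numeral_2_eq_2)

lemma P12_carrier: "(P12 :: 'a :: field mat) \<in> carrier_mat 2 2"
  by (simp add: P12_def mat_of_rows_list_def numeral_2_eq_2)

lemma P12_mult_vec:
  fixes v :: "'a :: field vec"
  assumes "v \<in> carrier_vec 2"
  shows "P12 *\<^sub>v v = vec 2 (\<lambda>j. v $ (1 - j))"
proof
  fix j assume "j < dim_vec (vec 2 (\<lambda>j. v $ (1 - j)))"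
  then have "j = 0 \<or> j = 1" by auto
  then show "(P12 *\<^sub>v v) $ j = vec 2 (\<lambda>j. v $ (1 - j)) $ j"
    using mult_mat_vec_entry_2[OF P12_carrier assms, of j]
    by (auto simp: P12_def mat_of_rows_list_def)
qed (simp add: P12_def mat_of_rows_list_def)

lemma weights_ok_carrier:
  assumes "weights_ok L d W" "1 \<le> k" "k \<le> L"
  shows "W k \<in> carrier_mat (if k = L then d else 2) 2"
  using assms by (auto simp: weights_ok_def)

lemma twisted_prod_Suc:
  "1 \<le> k \<Longrightarrow> twisted_prod W (Suc k) = W (Suc k) * P12 * twisted_prod W k"
  by (cases k) auto

lemma layer_out_Suc:
  "1 \<le> k \<Longrightarrow> layer_out W x (Suc k) = W (Suc k) *\<^sub>v map_vec (\<lambda>t. 1 / t) (layer_out W x k)"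
  by (cases k) auto

lemma twisted_prod_carrier:
  fixes W :: "nat \<Rightarrow> 'a :: field mat"
  assumes "weights_ok L d W" "1 \<le> k" "k \<le> L"
  shows "twisted_prod W k \<in> carrier_mat (if k = L then d else 2) 2"
  using assms(2,3)
proof (induction k rule: nat_induct_at_least)
  case base
  then show ?case using weights_ok_carrier[OF assms(1), of 1] by simp
next
  case (Suc k)
  then have "twisted_prod W k \<in> carrier_mat 2 2" by simp
  with Suc weights_ok_carrier[OF assms(1), of "Suc k"] show ?case
    by (auto simp: twisted_prod_Suc intro!: mult_carrier_mat[of _ _ 2] P12_carrier)
qed

lemma p_forms_carrier:
  fixes W :: "nat \<Rightarrow> 'a :: field mat"
  assumes "weights_ok L d W" "1 \<le> k" "k \<le> L"
  shows "p_forms W x k \<in> carrier_vec (if k = L then d else 2)"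
  using twisted_prod_carrier[OF assms] unfolding p_forms_def carrier_vec_def by auto

lemma p_forms_Suc:
  fixes W :: "nat \<Rightarrow> 'a :: field mat"
  assumes "weights_ok L d W" "x \<in> carrier_vec 2" "1 \<le> k" "k < L"
  shows "p_forms W x (Suc k) = W (Suc k) *\<^sub>v (P12 *\<^sub>v p_forms W x k)"
proof -
  define n where "n = (if Suc k = L then d else 2)"
  have W: "W (Suc k) \<in> carrier_mat n 2"
    using weights_ok_carrier[OF assms(1), of "Suc k"] assms(4) by (simp add: n_def)
  have T: "twisted_prod W k \<in> carrier_mat 2 2"
    using twisted_prod_carrier[OF assms(1,3)] assms(4) by simp
  have "p_forms W x (Suc k) = (W (Suc k) * P12) *\<^sub>v p_forms W x k"
    unfolding p_forms_def twisted_prod_Suc[OF assms(3)]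
    using assoc_mult_mat_vec[OF mult_carrier_mat[OF W P12_carrier] T assms(2)] .
  also have "\<dots> = W (Suc k) *\<^sub>v (P12 *\<^sub>v p_forms W x k)"
    using p_forms_carrier[OF assms(1,3)] assms(4)
    by (intro assoc_mult_mat_vec[OF W P12_carrier]) auto
  finally show ?thesis .
qed

text \<open>The matrix of the quadratic form is \<open>T\<^sup>T P12 T\<close> with \<open>p = T x\<close>, so its value at \<open>x\<close> is
  half the inner product of \<open>p\<close> with its own swap, and both summands equal \<open>p\<^sub>0 p\<^sub>1\<close>.\<close>

lemma q_form_eq_entry_product:
  fixes W :: "nat \<Rightarrow> 'a :: field mat"
  assumes "weights_ok L d W" "x \<in> carrier_vec 2" "(2 :: 'a) \<noteq> 0" "1 \<le> k" "k < L"
  shows "q_form W x (Suc k) = p_forms W x k $ 0 * p_forms W x k $ 1"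
proof -
  define T where "T = twisted_prod W k"
  define p where "p = p_forms W x k"
  have T: "T \<in> carrier_mat 2 2"
    using twisted_prod_carrier[OF assms(1,4)] assms(5) by (simp add: T_def)
  have p: "p \<in> carrier_vec 2" and pT: "p = T *\<^sub>v x"
    using p_forms_carrier[OF assms(1,4)] assms(5) by (simp_all add: p_def p_forms_def T_def)
  have Tt: "transpose_mat T \<in> carrier_mat 2 2" using T by simp
  have Pp: "P12 *\<^sub>v p \<in> carrier_vec 2" using P12_carrier p by (rule mult_mat_vec_carrier)
  have "(transpose_mat T * P12 * T) *\<^sub>v x = (transpose_mat T * P12) *\<^sub>v p"
    unfolding pT by (rule assoc_mult_mat_vec[OF mult_carrier_mat[OF Tt P12_carrier] T assms(2)])
  also have "\<dots> = transpose_mat T *\<^sub>v (P12 *\<^sub>v p)"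
    by (rule assoc_mult_mat_vec[OF Tt P12_carrier p])
  finally have "x \<bullet> ((transpose_mat T * P12 * T) *\<^sub>v x) = (transpose_mat T *\<^sub>v (P12 *\<^sub>v p)) \<bullet> x"
    using comm_scalar_prod[OF assms(2) mult_mat_vec_carrier[OF Tt Pp]] by simp
  also have "\<dots> = (P12 *\<^sub>v p) \<bullet> p"
    unfolding pT using transpose_vec_mult_scalar[OF T assms(2) Pp] by (simp add: pT)
  also have "\<dots> = 2 * (p $ 0 * p $ 1)"
    using p by (simp add: P12_mult_vec scalar_prod_def numeral_2_eq_2)
  finally have "q_form W x (Suc k) = 1 / 2 * (2 * (p $ 0 * p $ 1))"
    using assms(4) by (cases k) (simp_all add: T_def)
  then show ?thesis using assms(3) by (simp add: p_def)
qed

section \<open>The scalar factor of each layer\<close>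

lemma Q_den_0: "Q_den 0 W x = 1"
  and Q_den_1: "Q_den (Suc 0) W x = 1"
proof -
  have *: "{i. delta 0 \<le> i \<and> i \<le> 0 \<and> even (0 - i)} = {0}"
    "{i. delta (Suc 0) \<le> i \<and> i \<le> Suc 0 \<and> even (Suc 0 - i)} = {Suc 0}"
    by (auto simp: delta_def le_Suc_eq)
  show "Q_den 0 W x = 1" "Q_den (Suc 0) W x = 1"
    unfolding Q_den_def * by simp_all
qed

lemma Q_den_Suc:
  assumes "1 \<le> k"
  shows "Q_den (Suc k) W x = q_form W x (Suc k) * Q_den (k - 1) W x"
proof -
  obtain m where k: "k = Suc m" using assms by (cases k) auto
  have *: "{i. delta (Suc (Suc m)) \<le> i \<and> i \<le> Suc (Suc m) \<and> even (Suc (Suc m) - i)} =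
      insert (Suc (Suc m)) {i. delta m \<le> i \<and> i \<le> m \<and> even (m - i)}" (is "?A = ?B")
  proof (rule Set.set_eqI)
    fix i
    consider "i \<le> m" | "i = Suc m" | "i = Suc (Suc m)" | "i > Suc (Suc m)" by linarith
    then show "i \<in> ?A \<longleftrightarrow> i \<in> ?B"
      by cases (auto simp: delta_def Suc_diff_le)
  qed
  have "finite {i. delta m \<le> i \<and> i \<le> m \<and> even (m - i)}"
    by (rule finite_subset[of _ "{..m}"]) auto
  then show ?thesis unfolding k Q_den_def * by (subst prod.insert) auto
qed

text \<open>The numerator of depth \<open>L\<close> carries the same product of quadratic forms as the denominator
  of depth \<open>L - 1\<close>, because \<open>L + 1\<close> and \<open>L - 1\<close> have the same parity.\<close>

lemma P_num_eq_p_form_times_Q_den: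
  "1 \<le> L \<Longrightarrow> P_num L W x j = p_forms W x L $ j * Q_den (L - 1) W x"
  by (cases L) (simp_all add: P_num_def Q_den_def delta_def)

lemma Q_den_nonzero:
  fixes W :: "nat \<Rightarrow> 'a :: field mat"
  assumes "weights_ok L d W" "x \<in> carrier_vec 2" "(2 :: 'a) \<noteq> 0"
    and "\<And>i j. 1 \<le> i \<Longrightarrow> i < k \<Longrightarrow> j < 2 \<Longrightarrow> p_forms W x i $ j \<noteq> 0"
    and "k \<le> L"
  shows "Q_den k W x \<noteq> 0"
  using assms(4,5)
proof (induction k rule: less_induct)
  case (less k)
  consider "k = 0" | "k = Suc 0" | m where "k = Suc m" "1 \<le> m"
    by (cases k) (auto simp: Suc_le_eq)
  then show ?case
  proof cases
    case 3
    have "Q_den (m - 1) W x \<noteq> 0" using less 3 by auto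
    moreover have "q_form W x (Suc m) \<noteq> 0"
      using q_form_eq_entry_product[OF assms(1-3) \<open>1 \<le> m\<close>] less.prems 3 by auto
    ultimately show ?thesis using 3 Q_den_Suc[of m W x] by simp
  qed (simp_all add: Q_den_0 Q_den_1)
qed

text \<open>One step of the induction: if layer \<open>k\<close> outputs \<open>(D\<^sub>k\<^sub>-\<^sub>1 / D\<^sub>k) p\<^sub>k\<close>, then entrywise inversion
  gives \<open>D\<^sub>k / (D\<^sub>k\<^sub>-\<^sub>1 q\<^sub>k\<^sub>+\<^sub>1)\<close> times the swap of \<open>p\<^sub>k\<close>, and \<open>D\<^sub>k\<^sub>-\<^sub>1 q\<^sub>k\<^sub>+\<^sub>1 = D\<^sub>k\<^sub>+\<^sub>1\<close>.\<close>

lemma layer_out_eq_smult_p_forms: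
  fixes W :: "nat \<Rightarrow> 'a :: field mat"
  assumes "weights_ok L d W" "x \<in> carrier_vec 2" "(2 :: 'a) \<noteq> 0"
    and "\<And>i j. 1 \<le> i \<Longrightarrow> i < k \<Longrightarrow> j < 2 \<Longrightarrow> p_forms W x i $ j \<noteq> 0"
    and "1 \<le> k" "k \<le> L"
  shows "layer_out W x k = (Q_den (k - 1) W x / Q_den k W x) \<cdot>\<^sub>v p_forms W x k"
  using assms(5,4,6)
proof (induction k rule: nat_induct_at_least)
  case base
  then show ?case by (simp add: p_forms_def Q_den_0 Q_den_1)
next
  case (Suc k)
  let ?p = "p_forms W x k" and ?D = "\<lambda>k. Q_den k W x"
  have p: "?p \<in> carrier_vec 2"
    using p_forms_carrier[OF assms(1) Suc.hyps] Suc.prems(2) by simp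
  have nz: "?p $ 0 \<noteq> 0" "?p $ 1 \<noteq> 0"
    using Suc.prems(1)[of k] Suc.hyps by auto
  have q: "q_form W x (Suc k) = ?p $ 0 * ?p $ 1"
    using q_form_eq_entry_product[OF assms(1-3) Suc.hyps] Suc.prems(2) by simp
  have D: "?D k \<noteq> 0" "?D (k - 1) \<noteq> 0"
    using Suc.prems by (intro Q_den_nonzero[OF assms(1-3)]; simp)+
  have D': "?D (Suc k) = ?p $ 0 * ?p $ 1 * ?D (k - 1)"
    using Q_den_Suc[OF Suc.hyps, of W x] q by simp
  have IH: "layer_out W x k = (?D (k - 1) / ?D k) \<cdot>\<^sub>v ?p"
    using Suc by auto
  have "map_vec (\<lambda>t. 1 / t) (layer_out W x k) = (?D k / ?D (Suc k)) \<cdot>\<^sub>v (P12 *\<^sub>v ?p)"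
  proof
    fix j assume "j < dim_vec ((?D k / ?D (Suc k)) \<cdot>\<^sub>v (P12 *\<^sub>v ?p))"
    then have "j = 0 \<or> j = 1" using p by (auto simp: P12_mult_vec)
    then show "map_vec (\<lambda>t. 1 / t) (layer_out W x k) $ j =
        ((?D k / ?D (Suc k)) \<cdot>\<^sub>v (P12 *\<^sub>v ?p)) $ j"
      using p nz D unfolding IH D' by (auto simp: P12_mult_vec field_simps)
  qed (use p in \<open>simp add: IH P12_mult_vec\<close>)
  then have "layer_out W x (Suc k) = W (Suc k) *\<^sub>v ((?D k / ?D (Suc k)) \<cdot>\<^sub>v (P12 *\<^sub>v ?p))"
    using layer_out_Suc[OF Suc.hyps, of W x] by simp
  also have "\<dots> = (?D k / ?D (Suc k)) \<cdot>\<^sub>v (W (Suc k) *\<^sub>v (P12 *\<^sub>v ?p))"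
    using weights_ok_carrier[OF assms(1), of "Suc k"] Suc.prems(2)
      mult_mat_vec_carrier[OF P12_carrier p]
    by (intro mult_mat_vec) auto
  also have "W (Suc k) *\<^sub>v (P12 *\<^sub>v ?p) = p_forms W x (Suc k)"
    using p_forms_Suc[OF assms(1,2) Suc.hyps] Suc.prems(2) by simp
  finally show ?case by simp
qed

lemma network_defined_iff:
  fixes W :: "nat \<Rightarrow> 'a :: field mat"
  assumes "weights_ok L d W" "x \<in> carrier_vec 2" "(2 :: 'a) \<noteq> 0"
  shows "network_defined L W x \<longleftrightarrow> (\<forall>k\<in>{1..<L}. \<forall>j<2. p_forms W x k $ j \<noteq> 0)"
proof -
  \<comment> \<open>Nonvanishing of the earlier forms makes the scalar factor of layer \<open>k\<close> nonzero, so that the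
    output and the form at layer \<open>k\<close> vanish together.\<close>
  have layer: "(\<forall>j < dim_vec (layer_out W x k). layer_out W x k $ j \<noteq> 0) \<longleftrightarrow>
      (\<forall>j<2. p_forms W x k $ j \<noteq> 0)"
    if k: "1 \<le> k" "k < L" and nz: "\<And>i j. 1 \<le> i \<Longrightarrow> i < k \<Longrightarrow> j < 2 \<Longrightarrow> p_forms W x i $ j \<noteq> 0" for k
  proof -
    have "Q_den k W x \<noteq> 0" "Q_den (k - 1) W x \<noteq> 0"
      using k nz by (intro Q_den_nonzero[OF assms]; simp)+
    moreover have "p_forms W x k \<in> carrier_vec 2"
      using p_forms_carrier[OF assms(1), of k] k by simp
    moreover have "layer_out W x k = (Q_den (k - 1) W x / Q_den k W x) \<cdot>\<^sub>v p_forms W x k"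
      using k nz by (intro layer_out_eq_smult_p_forms[OF assms]) auto
    ultimately show ?thesis by auto
  qed
  show ?thesis
  proof
    assume def: "network_defined L W x"
    have "\<forall>j<2. p_forms W x k $ j \<noteq> 0" if "1 \<le> k" "k < L" for k
      using that
    proof (induction k rule: less_induct)
      case (less k)
      then have "\<And>i j. 1 \<le> i \<Longrightarrow> i < k \<Longrightarrow> j < 2 \<Longrightarrow> p_forms W x i $ j \<noteq> 0" by auto
      from layer[OF less.prems this] def less.prems show ?case
        by (auto simp: network_defined_def)
    qed
    then show "\<forall>k\<in>{1..<L}. \<forall>j<2. p_forms W x k $ j \<noteq> 0" by simp
  next
    assume "\<forall>k\<in>{1..<L}. \<forall>j<2. p_forms W x k $ j \<noteq> 0"
    then show "network_defined L W x"
      unfolding network_defined_def by (intro ballI, subst layer) auto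
  qed
qed

lemma network_eq_quotients:
  fixes W :: "nat \<Rightarrow> 'a :: field mat"
  assumes "1 \<le> L" "weights_ok L d W" "x \<in> carrier_vec 2" "(2 :: 'a) \<noteq> 0" "network_defined L W x"
  shows "Q_den L W x \<noteq> 0"
    and "network L W x = vec d (\<lambda>j. P_num L W x j / Q_den L W x)"
proof -
  have nz: "p_forms W x i $ j \<noteq> 0" if "1 \<le> i" "i < L" "j < 2" for i j
    using network_defined_iff[OF assms(2-4)] assms(5) that by auto
  then show "Q_den L W x \<noteq> 0"
    by (intro Q_den_nonzero[OF assms(2-4)]) auto
  have "layer_out W x L = (Q_den (L - 1) W x / Q_den L W x) \<cdot>\<^sub>v p_forms W x L"
    using nz assms(1) by (intro layer_out_eq_smult_p_forms[OF assms(2-4)]) auto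
  then show "network L W x = vec d (\<lambda>j. P_num L W x j / Q_den L W x)"
    using p_forms_carrier[OF assms(2,1) order_refl, of x] assms(1)
    by (intro eq_vecI) (auto simp: network_def P_num_eq_p_form_times_Q_den)
qed

section \<open>Polynomials with nonnegative coefficients\<close>

lemma lookup_mult_nonneg:
  fixes f g :: "'a :: comm_monoid_add \<Rightarrow>\<^sub>0 'b :: linordered_idom"
  assumes "\<And>m. 0 \<le> Poly_Mapping.lookup f m" "\<And>m. 0 \<le> Poly_Mapping.lookup g m"
  shows "0 \<le> Poly_Mapping.lookup (f * g) m"
  unfolding lookup_mult Sum_any.expand_set
  by (intro sum_nonneg mult_nonneg_nonneg assms) (auto simp: when_def assms)

lemma add_nonneg_eq_0:
  fixes f g :: "'a \<Rightarrow>\<^sub>0 'b :: linordered_idom"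
  assumes "\<And>m. 0 \<le> Poly_Mapping.lookup f m" "\<And>m. 0 \<le> Poly_Mapping.lookup g m" "f + g = 0"
  shows "f = 0"
proof (rule poly_mapping_eqI)
  fix m
  have "Poly_Mapping.lookup f m + Poly_Mapping.lookup g m = 0"
    using assms(3) by (metis lookup_add lookup_zero)
  then show "Poly_Mapping.lookup f m = Poly_Mapping.lookup 0 m"
    using assms(1,2) by (simp add: add_nonneg_eq_0_iff)
qed

text \<open>Nonnegativity of the coefficients is what makes nonvanishing stable under sums.\<close>

definition positive_form :: "nat \<Rightarrow> wfun \<Rightarrow> bool" where
  "positive_form n r \<longleftrightarrow> (\<exists>f. r = to_fract f \<and> f \<noteq> 0 \<and> (\<forall>m. 0 \<le> Poly_Mapping.lookup f m) \<and>
     (\<forall>m\<in>Poly_Mapping.keys f. input_degree m = n))"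

lemma positive_form_nonzero: "positive_form n r \<Longrightarrow> r \<noteq> 0"
  by (auto simp: positive_form_def)

lemma positive_form_is_homogeneous_poly: "positive_form n r \<Longrightarrow> is_homogeneous_poly r"
  unfolding positive_form_def is_homogeneous_poly_def homogeneous_in_input_def by blast

lemma positive_form_add:
  assumes "positive_form n r" "positive_form n s"
  shows "positive_form n (r + s)"
proof -
  from assms obtain f g where fg: "r = to_fract f" "s = to_fract g" "f \<noteq> 0"
    "\<And>m. 0 \<le> Poly_Mapping.lookup f m" "\<And>m. 0 \<le> Poly_Mapping.lookup g m"
    "\<forall>m\<in>Poly_Mapping.keys f. input_degree m = n" "\<forall>m\<in>Poly_Mapping.keys g. input_degree m = n"
    unfolding positive_form_def by blast
  have "f + g \<noteq> 0" using add_nonneg_eq_0[OF fg(4,5)] fg(3) by blast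
  moreover have "\<forall>m\<in>Poly_Mapping.keys (f + g). input_degree m = n"
    using Poly_Mapping.keys_add[of f g] fg(6,7) by blast
  ultimately show ?thesis
    unfolding positive_form_def
    using fg by (intro exI[of _ "f + g"]) (simp add: lookup_add)
qed

lemma positive_form_mult:
  assumes "positive_form m r" "positive_form n s"
  shows "positive_form (m + n) (r * s)"
proof -
  from assms obtain f g where fg: "r = to_fract f" "s = to_fract g" "f \<noteq> 0" "g \<noteq> 0"
    "\<And>m. 0 \<le> Poly_Mapping.lookup f m" "\<And>m. 0 \<le> Poly_Mapping.lookup g m"
    "\<forall>k\<in>Poly_Mapping.keys f. input_degree k = m" "\<forall>k\<in>Poly_Mapping.keys g. input_degree k = n"
    unfolding positive_form_def by blast
  have "\<forall>k\<in>Poly_Mapping.keys (f * g). input_degree k = m + n"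
    using Poly_Mapping.keys_mult[of f g] fg(7,8)
    by (fastforce simp: input_degree_def lookup_add sum.distrib)
  then show ?thesis
    unfolding positive_form_def
    using fg lookup_mult_nonneg[OF fg(5,6)] by (intro exI[of _ "f * g"]) simp
qed

lemma positive_form_1: "positive_form 0 1"
  unfolding positive_form_def
  by (intro exI[of _ 1]) (auto simp: lookup_one when_def input_degree_def)

text \<open>The sum is the input degree of the monomial \<open>v\<close>, written as in \<open>input_degree\<close> so that
  weights and inputs are covered at once; it is 0 for a weight and 1 for \<open>X 0\<close> and \<open>X 1\<close>.\<close>

lemma positive_form_var:
  "positive_form (\<Sum>j<2. if v = X j then 1 else 0) (var_fun v)"
proof -
  have "Poly_Mapping.single (Poly_Mapping.single v (1 :: nat)) (1 :: real) \<noteq> 0"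
    by (metis lookup_single_eq lookup_zero zero_neq_one)
  then show ?thesis
    unfolding positive_form_def var_fun_def
    by (intro exI[of _ "Poly_Mapping.single (Poly_Mapping.single v 1) 1"])
      (auto simp: lookup_single when_def input_degree_def intro!: sum.cong)
qed

lemma positive_form_weight: "positive_form 0 (var_fun (Wt k i j))"
  using positive_form_var[of "Wt k i j"] by simp

lemma positive_form_input: "j < 2 \<Longrightarrow> positive_form 1 (var_fun (X j))"
  using positive_form_var[of "X j"] by (simp add: sum.delta')

section \<open>Generic weights\<close>

lemma two_wfun_nonzero: "(2 :: wfun) \<noteq> 0"
proof -
  have "(2 :: wfun) = to_fract (1 + 1)" by (metis one_add_one to_fract_1 to_fract_add)
  moreover have "(1 + 1 :: wpoly) \<noteq> 0" by simp
  ultimately show ?thesis by (simp only: to_fract_eq_0_iff not_False_eq_True)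
qed

lemma weights_ok_generic: "1 \<le> L \<Longrightarrow> weights_ok L d (generic_weights L d)"
  by (auto simp: weights_ok_def generic_weights_def)

lemma generic_input_carrier: "generic_input \<in> carrier_vec 2"
  by (simp add: generic_input_def)

lemma positive_form_generic_mult_vec:
  assumes "v \<in> carrier_vec 2" "\<And>i. i < 2 \<Longrightarrow> positive_form n (v $ i)"
    and "j < (if k = L then d else 2)"
  shows "positive_form n ((generic_weights L d k *\<^sub>v v) $ j)"
proof -
  have "positive_form (0 + n) (var_fun (Wt k j i) * v $ i)" if "i < 2" for i
    using positive_form_mult[OF positive_form_weight assms(2)[OF that]] .
  then have "positive_form n (var_fun (Wt k j 0) * v $ 0 + var_fun (Wt k j 1) * v $ 1)"
    using positive_form_add by simp
  moreover have "generic_weights L d k \<in> carrier_mat (if k = L then d else 2) 2"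
    by (simp add: generic_weights_def)
  ultimately show ?thesis
    using mult_mat_vec_entry_2[OF _ assms(1,3), of "generic_weights L d k"] assms(3)
    by (simp add: generic_weights_def)
qed

lemma positive_form_generic_p_forms:
  assumes "1 \<le> k" "k \<le> L" "j < (if k = L then d else 2)"
  shows "positive_form 1 (p_forms (generic_weights L d) generic_input k $ j)"
  using assms
proof (induction k arbitrary: j rule: nat_induct_at_least)
  case base
  then show ?case
    using positive_form_generic_mult_vec[OF generic_input_carrier, of 1 j 1 L d]
      positive_form_input
    by (simp add: p_forms_def generic_input_def)
next
  case (Suc k)
  let ?p = "p_forms (generic_weights L d) generic_input k"
  have ok: "weights_ok L d (generic_weights L d)" using Suc.prems by (intro weights_ok_generic) auto
  have p: "?p \<in> carrier_vec 2"
    using p_forms_carrier[OF ok Suc.hyps] Suc.prems(1) by simp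
  have "positive_form 1 ((generic_weights L d (Suc k) *\<^sub>v (P12 *\<^sub>v ?p)) $ j)"
    using Suc.IH Suc.prems p
    by (intro positive_form_generic_mult_vec) (auto simp: P12_mult_vec)
  then show ?case
    using p_forms_Suc[OF ok generic_input_carrier Suc.hyps] Suc.prems(1) by simp
qed

lemma positive_form_generic_Q_den:
  "k \<le> L \<Longrightarrow> \<exists>n. positive_form n (Q_den k (generic_weights L d) generic_input)"
proof (induction k rule: less_induct)
  case (less k)
  let ?q = "q_form (generic_weights L d) generic_input"
  consider "k = 0" | "k = Suc 0" | m where "k = Suc m" "1 \<le> m"
    by (cases k) (auto simp: Suc_le_eq)
  then show ?case
  proof cases
    case 3
    have ok: "weights_ok L d (generic_weights L d)"
      using less.prems 3 by (intro weights_ok_generic) auto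
    have "?q k = p_forms (generic_weights L d) generic_input m $ 0 *
        p_forms (generic_weights L d) generic_input m $ 1"
      using q_form_eq_entry_product[OF ok generic_input_carrier two_wfun_nonzero] less.prems 3
      by simp
    moreover have "positive_form 1 (p_forms (generic_weights L d) generic_input m $ j)"
      if "j < 2" for j
      using that less.prems 3 by (intro positive_form_generic_p_forms) auto
    ultimately have "positive_form (1 + 1) (?q k)"
      using positive_form_mult[of 1 _ 1] by (metis pos2 one_less_numeral_iff semiring_norm(76))
    moreover obtain n where "positive_form n (Q_den (m - 1) (generic_weights L d) generic_input)"
    proof -
      have "m - 1 < k" "m - 1 \<le> L" using less.prems 3(1) by auto
      with less.IH that show thesis by blast
    qed
    ultimately show ?thesis
      using Q_den_Suc[OF 3(2), of "generic_weights L d" generic_input] positive_form_mult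
      unfolding 3(1) by metis
  qed (use positive_form_1 in \<open>auto simp: Q_den_0 Q_den_1\<close>)
qed

theorem proposition5p1:
  fixes L d :: nat
  assumes "L \<ge> 1" and "d \<ge> 1"
  shows
    "network_defined L (generic_weights L d) generic_input \<and>
     Q_den L (generic_weights L d) generic_input \<noteq> 0 \<and>
     network L (generic_weights L d) generic_input =
       vec d (\<lambda>j. P_num L (generic_weights L d) generic_input j /
                  Q_den L (generic_weights L d) generic_input) \<and>
     (\<forall>j<d. is_homogeneous_poly (P_num L (generic_weights L d) generic_input j)) \<and>
     is_homogeneous_poly (Q_den L (generic_weights L d) generic_input) \<and>
     (\<forall>(W :: nat \<Rightarrow> real mat) x.
        weights_ok L d W \<longrightarrow> x \<in> carrier_vec 2 \<longrightarrow> network_defined L W x \<longrightarrow>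
          Q_den L W x \<noteq> 0 \<and>
          network L W x = vec d (\<lambda>j. P_num L W x j / Q_den L W x))"
proof -
  let ?W = "generic_weights L d" and ?x = generic_input
  have ok: "weights_ok L d ?W" using assms(1) by (rule weights_ok_generic)
  have def: "network_defined L ?W ?x"
    using positive_form_nonzero[OF positive_form_generic_p_forms]
    by (subst network_defined_iff[OF ok generic_input_carrier two_wfun_nonzero]) simp
  obtain n where n: "positive_form n (Q_den (L - 1) ?W ?x)"
    using positive_form_generic_Q_den[of "L - 1" L d] by auto
  have "is_homogeneous_poly (P_num L ?W ?x j)" if "j < d" for j
    using positive_form_mult[OF positive_form_generic_p_forms[of L L j d] n] assms(1) that
    by (simp add: P_num_eq_p_form_times_Q_den positive_form_is_homogeneous_poly)
  moreover have "is_homogeneous_poly (Q_den L ?W ?x)"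
    using positive_form_generic_Q_den[of L L d] positive_form_is_homogeneous_poly by blast
  ultimately show ?thesis
    using def network_eq_quotients[OF assms(1) ok generic_input_carrier two_wfun_nonzero def]
      network_eq_quotients[OF assms(1), where 'a = real]
    by simp
qed

end
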